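(* If $n > 1$ is an integer, then \[ \sum_{d=1}^{n+1} \mu(d)\, 2^{\lfloor (n+1)/d\rfloor - \lfloor (n-1)/d\rfloor} = 1 + M(n+1). \]
   Context: $\mu$ is the Möbius function, $\lfloor x\rfloor$ is the floor of $x$, and $M(n) = \sum_{d=1}^n \mu(d)$ is the Mertens function. *)

theory Defs
  imports Complex_Main "HOL-Computational_Algebra.Computational_Algebra"
begin

definition moebius_mu :: "nat \<Rightarrow> int" where
  "moebius_mu n = (if squarefree n then (-1) ^ card (prime_factors n) else 0)"

definition mertens :: "nat \<Rightarrow> int" where
  "mertens n = (\<Sum>d=1..n. moebius_mu d)"

end

theory Submission
  imports Defs
begin

text \<open>
  The exponent counts the multiples of \<open>d\<close> among \<open>n\<close> and \<open>n + 1\<close>. As \<open>2 ^ (a + b) = 1 + a + b + a * b\<close>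
  for \<open>a, b \<in> {0, 1}\<close>, the sum splits into the Mertens function, the two divisor sums of \<open>\<mu>\<close> at
  \<open>n\<close> and \<open>n + 1\<close> (both zero because \<open>n > 1\<close>), and the contribution of the common divisors of \<open>n\<close>
  and \<open>n + 1\<close>, of which there is only \<open>d = 1\<close>.
\<close>

lemma moebius_mu_1: "moebius_mu 1 = 1"
  by (simp add: moebius_mu_def)

lemma squarefree_prime_mult_iff:
  fixes p d :: nat
  assumes "prime p" "\<not> p dvd d"
  shows "squarefree (p * d) \<longleftrightarrow> squarefree d"
proof -
  have "coprime p d"
    using assms by (simp add: prime_imp_coprime)
  then show ?thesis
    using assms by (auto simp: squarefree_mult_coprime squarefree_prime dest: squarefree_multD)
qed

text \<open>A new prime leaves squarefreeness unchanged and adds exactly one prime factor, which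
  flips the sign; if \<open>d\<close> is not squarefree, both sides vanish.\<close>

lemma moebius_mu_prime_mult:
  assumes "prime p" "\<not> p dvd d"
  shows "moebius_mu (p * d) = - moebius_mu d"
proof -
  have "d \<noteq> 0"
    using assms by (metis dvd_0_right)
  moreover have "p \<noteq> 0"
    using assms by auto
  ultimately have "prime_factors (p * d) = insert p (prime_factors d)"
    using assms by (simp add: prime_factors_product prime_prime_factors)
  moreover have "p \<notin> prime_factors d"
    using assms by auto
  ultimately have "card (prime_factors (p * d)) = Suc (card (prime_factors d))"
    by simp
  then show ?thesis
    using assms by (simp add: moebius_mu_def squarefree_prime_mult_iff)
qed

text \<open>Fix a prime \<open>p\<close> dividing \<open>m\<close>. Only squarefree divisors count,
  and they fall into pairs \<open>d\<close>, \<open>p * d\<close> with \<open>d\<close> prime to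
  \<open>p\<close>, whose values cancel.\<close>

lemma sum_moebius_mu_divisors:
  fixes m :: nat
  assumes "m > 1"
  shows "(\<Sum>d | d dvd m. moebius_mu d) = 0"
proof -
  obtain p where p: "prime p" "p dvd m"
    using assms prime_factor_nat by (metis less_irrefl)
  define A where "A = {d. d dvd m \<and> squarefree d \<and> \<not> p dvd d}"
  have fin: "finite {d. d dvd m}"
    using assms by simp
  have finA: "finite A"
    by (rule finite_subset[OF _ fin]) (auto simp: A_def)
  have D: "{d. d dvd m \<and> squarefree d} = A \<union> (*) p ` A"
  proof (intro equalityI subsetI)
    fix d assume d: "d \<in> {d. d dvd m \<and> squarefree d}"
    show "d \<in> A \<union> (*) p ` A"
    proof (cases "p dvd d")
      case True
      then obtain e where e: "d = p * e" by blast
      \<comment> \<open>Otherwise the square of \<open>p\<close> would divide the squarefree number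
        \<open>d\<close>.\<close>
      have "\<not> p dvd e"
        using d p e squarefreeD[of d p] by (auto simp: power2_eq_square)
      moreover have "squarefree e" "e dvd m"
        using d e by (auto dest: squarefree_multD dvd_mult_right)
      ultimately show ?thesis
        using e by (auto simp: A_def)
    qed (use d in \<open>auto simp: A_def\<close>)
  next
    fix d assume "d \<in> A \<union> (*) p ` A"
    \<comment> \<open>Since \<open>p\<close> and \<open>e\<close> are coprime and both divide
      \<open>m\<close>, so does their product.\<close>
    moreover have "p * e dvd m \<and> squarefree (p * e)" if "e \<in> A" for e
      using that p by (auto simp: A_def squarefree_prime_mult_iff prime_imp_coprime intro: divides_mult)
    ultimately show "d \<in> {d. d dvd m \<and> squarefree d}"
      by (auto simp: A_def)
  qed
  have "(\<Sum>d | d dvd m. moebius_mu d) = (\<Sum>d | d dvd m \<and> squarefree d. moebius_mu d)"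
    by (rule sum.mono_neutral_right[OF fin]) (auto simp: moebius_mu_def)
  also have "\<dots> = (\<Sum>d\<in>A. moebius_mu d) + (\<Sum>d\<in>(*) p ` A. moebius_mu d)"
    unfolding D by (rule sum.union_disjoint) (use finA in \<open>auto simp: A_def\<close>)
  also have "(\<Sum>d\<in>(*) p ` A. moebius_mu d) = (\<Sum>d\<in>A. moebius_mu (p * d))"
    using p by (subst sum.reindex) (auto simp: inj_on_def)
  also have "\<dots> = (\<Sum>d\<in>A. - moebius_mu d)"
    using p by (intro sum.cong) (auto simp: A_def moebius_mu_prime_mult)
  finally show ?thesis
    by (simp add: sum_negf)
qed

text \<open>The last indicator is the product of the two before it, as consecutive numbers share
  only the divisor 1. The assumption keeps \<open>n - 1\<close> from being truncated at 0.\<close>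

lemma two_power_div_diff:
  fixes n d :: nat
  assumes "n \<ge> 1"
  shows "(2::int) ^ ((n + 1) div d - (n - 1) div d) =
    1 + of_bool (d dvd n) + of_bool (d dvd n + 1) + of_bool (d = 1)"
proof (cases "d = 1")
  case False
  obtain k where k: "n = Suc k"
    using assms by (cases n) auto
  have "\<not> (d dvd n \<and> d dvd n + 1)"
    using False by (metis dvd_add_right_iff nat_dvd_1_iff_1)
  \<comment> \<open>From \<open>k\<close> to \<open>k + 2\<close> the quotient by \<open>d\<close>
    grows by one at each multiple of \<open>d\<close>; here there is at most one, so the power is 1
    or 2.\<close>
  then show ?thesis
    using False by (auto simp: k div_Suc dvd_eq_mod_eq_0)
qed (use assms in simp)

theorem theorem4:
  fixes n :: nat
  assumes "n > 1"
  shows "(\<Sum>d=1..n+1. moebius_mu d * 2 ^ ((n + 1) div d - (n - 1) div d)) = 1 + mertens (n + 1)"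
proof -
  have divisors: "(\<Sum>d=1..n+1. moebius_mu d * of_bool (d dvd m)) = 0" if "1 < m" "m \<le> n + 1" for m
  proof -
    \<comment> \<open>All divisors of \<open>m\<close> lie in the range of summation, so the
      indicator sum is the full divisor sum.\<close>
    have "d \<in> {1..n+1}" if "d dvd m" for d
      using dvd_imp_le[OF that] dvd_pos_nat[OF _ that] \<open>1 < m\<close> \<open>m \<le> n + 1\<close> by (simp add: Suc_le_eq)
    then have "(\<Sum>d | d dvd m. moebius_mu d) = (\<Sum>d=1..n+1. moebius_mu d * of_bool (d dvd m))"
      by (intro sum.mono_neutral_cong_left) auto
    then show ?thesis
      using sum_moebius_mu_divisors[OF that(1)] by simp
  qed
  have one: "(\<Sum>d=1..n+1. moebius_mu d * of_bool (d = 1)) = 1"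
    using moebius_mu_1 by (simp add: of_bool_def if_distrib cong: if_cong)
  have "(\<Sum>d=1..n+1. moebius_mu d * 2 ^ ((n + 1) div d - (n - 1) div d)) =
      (\<Sum>d=1..n+1. moebius_mu d + moebius_mu d * of_bool (d dvd n) +
        moebius_mu d * of_bool (d dvd n + 1) + moebius_mu d * of_bool (d = 1))"
    using assms by (intro sum.cong refl, subst two_power_div_diff) (auto simp: algebra_simps)
  \<comment> \<open>The hypothesis \<open>n > 1\<close> is what makes the divisor sum at
    \<open>n\<close> vanish; at \<open>n = 1\<close> it would be 1.\<close>
  also have "\<dots> = mertens (n + 1) + 0 + 0 + 1"
    using divisors[of n] divisors[of "n + 1"] one assms
    unfolding sum.distrib mertens_def by linarith
  finally show ?thesis
    by simp
qed

end
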